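(* For every integer $t\geq 2$, every (finite, simple) graph with no dominating $K_t$-model is $2^{t-2}$-colourable.
   Context: A dominating $K_t$-model in a graph $G$ is a sequence $(T_1,\dots,T_t)$ of pairwise disjoint non-empty connected subgraphs of $G$ such that for all $1\le i<j\le t$, every vertex of $T_j$ has a neighbour in $T_i$. *)

theory Defs
  imports "Graph_Theory.Digraph_Component" "HOL-Library.Disjoint_Sets" "HOL-Library.FuncSet"
begin

text \<open>
  Finite simple graphs are rendered by the locale \<^locale>\<open>graph\<close>: an undirected edge
  \<open>uv\<close> is a pair of opposite arcs. The constant \<^const>\<open>subgraph\<close> on its own admits subdigraphs
  that keep only one of these two arcs, hence the extra requirement that each \<open>T i\<close> be a
  graph again.
\<close>

definition dominating_K_model ::
    "('a, 'b) pre_digraph \<Rightarrow> nat \<Rightarrow> (nat \<Rightarrow> ('a, 'b) pre_digraph) \<Rightarrow> bool" where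
  "dominating_K_model G t T \<longleftrightarrow>
     (\<forall>i\<in>{1..t}. graph (T i) \<and> subgraph (T i) G \<and> verts (T i) \<noteq> {} \<and> connected (T i)) \<and>
     disjoint_family_on (\<lambda>i. verts (T i)) {1..t} \<and>
     (\<forall>i j. 1 \<le> i \<and> i < j \<and> j \<le> t \<longrightarrow>
        (\<forall>v\<in>verts (T j). \<exists>u\<in>verts (T i). v \<rightarrow>\<^bsub>G\<^esub> u))"

definition colourable :: "nat \<Rightarrow> ('a, 'b) pre_digraph \<Rightarrow> bool" where
  "colourable k G \<longleftrightarrow>
     (\<exists>c :: 'a \<Rightarrow> nat. c \<in> verts G \<rightarrow> {..<k} \<and> (\<forall>u v. u \<rightarrow>\<^bsub>G\<^esub> v \<longrightarrow> c u \<noteq> c v))"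

end

theory Submission
  imports Defs
begin

text \<open>
  Induction on \<open>t\<close>. Split every component of the graph into the layers of vertices at equal
  distance from a root. The vertices above a layer form a connected set dominating that layer,
  so a dominating \<open>K\<^sub>t\<^sub>-\<^sub>1\<close>-model in the layer would extend to a dominating \<open>K\<^sub>t\<close>-model. Hence
  each layer can be coloured with \<open>2 ^ (t - 3)\<close> colours, and two such palettes, used alternately
  on even and odd layers, suffice for the whole graph.
\<close>

text \<open>
  Dominating models in the vertex set \<open>W\<close> of a graph with adjacency relation \<open>E\<close>; each
  subgraph is represented by its vertex set, as it may be taken to be induced.
\<close>

definition dominating_sets :: "'a rel \<Rightarrow> 'a set \<Rightarrow> nat \<Rightarrow> (nat \<Rightarrow> 'a set) \<Rightarrow> bool" where
  "dominating_sets E W t S \<longleftrightarrow>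
     (\<forall>i\<in>{1..t}. S i \<subseteq> W \<and> S i \<noteq> {} \<and> (\<forall>x\<in>S i. \<forall>y\<in>S i. (x, y) \<in> rtrancl_on (S i) E)) \<and>
     disjoint_family_on S {1..t} \<and>
     (\<forall>i j. 1 \<le> i \<and> i < j \<and> j \<le> t \<longrightarrow> (\<forall>v\<in>S j. \<exists>u\<in>S i. (v, u) \<in> E))"

text \<open>One root is chosen in each connected component of \<open>F\<close>, and \<open>d\<close>
  is the distance from it. The four properties are all that the colouring needs of a breadth-first
  search.\<close>

lemma distance_layers:
  fixes F :: "'a rel"
  assumes "sym F"
  obtains r :: "'a \<Rightarrow> 'a" and d :: "'a \<Rightarrow> nat"
  where "\<And>x. d x = 0 \<Longrightarrow> x = r x"
    and "\<And>u v. (u, v) \<in> F \<Longrightarrow> r u = r v"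
    and "\<And>u v. (u, v) \<in> F \<Longrightarrow> d v \<le> Suc (d u)"
    and "\<And>v. 0 < d v \<Longrightarrow> \<exists>u. (u, v) \<in> F \<and> Suc (d u) = d v"
proof -
  define r where "r x = (SOME y. (x, y) \<in> F\<^sup>*)" for x
  define d where "d x = (LEAST n. (r x, x) \<in> F ^^ n)" for x
  have sym: "sym (F\<^sup>*)"
    using assms by (rule sym_rtrancl)
  have "(x, r x) \<in> F\<^sup>*" for x
    unfolding r_def by (rule someI[of _ x]) simp
  then have root: "(r x, x) \<in> F\<^sup>*" for x
    using sym by (blast dest: symD)
  \<comment> \<open>The predicates under \<open>SOME\<close> in \<open>r x\<close> and
    \<open>r y\<close> describe the same component, so the choices agree.\<close>
  have r_cong: "r x = r y" if "(x, y) \<in> F\<^sup>*" for x y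
  proof -
    have "(x, z) \<in> F\<^sup>* \<longleftrightarrow> (y, z) \<in> F\<^sup>*" for z
      using that sym by (meson rtrancl_trans symD)
    then show ?thesis
      by (simp add: r_def)
  qed
  have dist: "(r x, x) \<in> F ^^ d x" for x
    unfolding d_def using root[of x] by (metis LeastI rtrancl_imp_relpow)
  have d_le: "d x \<le> n" if "(r x, x) \<in> F ^^ n" for x n
    unfolding d_def using that by (rule Least_le)
  have step: "d v \<le> Suc (d u)" if "(u, v) \<in> F" for u v
    using dist[of u] that r_cong[OF r_into_rtrancl[OF that]] by (intro d_le) auto
  show thesis
  proof
    show "x = r x" if "d x = 0" for x
      using dist[of x] that by simp
    show "r u = r v" if "(u, v) \<in> F" for u v
      using that by (intro r_cong r_into_rtrancl)
    show "d v \<le> Suc (d u)" if "(u, v) \<in> F" for u v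
      using that by (rule step)
    show "\<exists>u. (u, v) \<in> F \<and> Suc (d u) = d v" if pos: "0 < d v" for v
    proof -
      obtain n where n: "d v = Suc n"
        using pos by (cases "d v") auto
      with dist[of v] obtain u where u: "(r v, u) \<in> F ^^ n" "(u, v) \<in> F"
        by auto
      \<comment> \<open>The last vertex before \<open>v\<close> on a shortest walk serves as its
        parent: the walk bounds \<open>d u\<close> from above, \<open>step\<close> bounds it from
        below.\<close>
      then have "d u \<le> n"
        using r_cong[OF r_into_rtrancl[OF u(2)]] by (intro d_le) auto
      with step[OF u(2)] n u(2) show ?thesis
        by (intro exI[of _ u] conjI) auto
    qed
  qed
qed

text \<open>In a model each later member has neighbours in every earlier one. So \<open>T\<close>,
  which dominates all of \<open>L\<close>, goes in front as member 1, and the members of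
  \<open>S\<close> move up by one place.\<close>

lemma dominating_sets_extend:
  assumes S: "dominating_sets E L t S" and "L \<subseteq> W" "T \<subseteq> W" "T \<noteq> {}" "T \<inter> L = {}"
    and conn: "\<And>x y. x \<in> T \<Longrightarrow> y \<in> T \<Longrightarrow> (x, y) \<in> rtrancl_on T E"
    and dom: "\<And>v. v \<in> L \<Longrightarrow> \<exists>u\<in>T. (v, u) \<in> E"
  shows "dominating_sets E W (Suc t) (\<lambda>i. if i = 1 then T else S (i - 1))"
    (is "dominating_sets E W _ ?S")
proof -
  have sub: "S i \<subseteq> L" if "i \<in> {1..t}" for i
    using S that by (auto simp: dominating_sets_def)
  have pred: "i - 1 \<in> {1..t}" if "i \<in> {1..Suc t}" "i \<noteq> 1" for i
    using that by auto
  have "?S i \<subseteq> W \<and> ?S i \<noteq> {} \<and> (\<forall>x\<in>?S i. \<forall>y\<in>?S i. (x, y) \<in> rtrancl_on (?S i) E)"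
    if i: "i \<in> {1..Suc t}" for i
  proof (cases "i = 1")
    case False
    with pred[OF i] have i': "i - 1 \<in> {1..t}" by blast
    from S i' have "S (i - 1) \<noteq> {} \<and>
        (\<forall>x\<in>S (i - 1). \<forall>y\<in>S (i - 1). (x, y) \<in> rtrancl_on (S (i - 1)) E)"
      unfolding dominating_sets_def by blast
    with False sub[OF i'] \<open>L \<subseteq> W\<close> show ?thesis by auto
  qed (use assms in auto)
  moreover have "disjoint_family_on ?S {1..Suc t}"
  unfolding disjoint_family_on_def
  proof (intro ballI impI)
    fix i j assume ij: "i \<in> {1..Suc t}" "j \<in> {1..Suc t}" "i \<noteq> j"
    have "S (i - 1) \<inter> S (j - 1) = {}" if "i \<noteq> 1" "j \<noteq> 1"
    proof -
      have "i - 1 \<noteq> j - 1" using ij that by auto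
      then show ?thesis
        using S pred ij that unfolding dominating_sets_def
        by (intro disjoint_family_onD[of S "{1..t}"]) auto
    qed
    then show "?S i \<inter> ?S j = {}"
      using ij sub[of "i - 1"] sub[of "j - 1"] pred[of i] pred[of j] \<open>T \<inter> L = {}\<close>
      by auto
  qed
  moreover have "\<exists>u\<in>?S i. (v, u) \<in> E" if ij: "1 \<le> i" "i < j" "j \<le> Suc t" "v \<in> ?S j" for i j v
  proof (cases "i = 1")
    case True
    then show ?thesis using ij sub[of "j - 1"] pred[of j] dom[of v] by auto
  next
    case False
    then have "1 \<le> i - 1 \<and> i - 1 < j - 1 \<and> j - 1 \<le> t \<and> v \<in> S (j - 1)"
      using ij by auto
    then show ?thesis using S False unfolding dominating_sets_def by (auto split del: if_split)
  qed
  ultimately show ?thesis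
    unfolding dominating_sets_def by blast
qed

text \<open>The induction passes to layers, hence the arbitrary vertex set \<open>W\<close>;
  \<open>k\<close> stands for \<open>t - 2\<close>, which avoids truncated subtraction.\<close>

lemma colouring_if_no_dominating_sets:
  fixes E :: "'a rel"
  assumes "sym E" "irrefl E"
    and "\<nexists>S. dominating_sets E W (k + 2) S"
  shows "\<exists>c. c \<in> W \<rightarrow> {..<2 ^ k :: nat} \<and> (\<forall>u\<in>W. \<forall>v\<in>W. (u, v) \<in> E \<longrightarrow> c u \<noteq> c v)"
  using assms(3)
proof (induction k arbitrary: W)
  case 0
  have "(u, v) \<notin> E" if "u \<in> W" "v \<in> W" for u v
  proof
    assume uv: "(u, v) \<in> E"
    then have vu: "(v, u) \<in> E" and "u \<noteq> v"
      using assms(1,2) by (blast dest: symD, auto simp: irrefl_def)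
    \<comment> \<open>The two ends of an edge already form a model with two members, so
      \<open>W\<close> is independent and one colour is enough.\<close>
    have "dominating_sets E W 2 (\<lambda>i. if i = 1 then {u} else {v})"
      using that vu \<open>u \<noteq> v\<close> by (auto simp: dominating_sets_def disjoint_family_on_def)
    with 0 show False by (metis add_0)
  qed
  then show ?case by (intro exI[of _ "\<lambda>_. 0"]) auto
next
  case (Suc k)
  \<comment> \<open>Distances are measured inside \<open>W\<close>, so that parents lie in
    \<open>W\<close> again.\<close>
  define F where "F = E \<inter> W \<times> W"
  have "sym F"
    using \<open>sym E\<close> by (auto simp: F_def sym_def)
  then have F_sym: "(v, u) \<in> F" if "(u, v) \<in> F" for u v
    using that by (rule symD)
  obtain r d where d0: "\<And>x. d x = (0::nat) \<Longrightarrow> x = r x"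
      and r_edge: "\<And>u v. (u, v) \<in> F \<Longrightarrow> r u = r v"
      and d_edge: "\<And>u v. (u, v) \<in> F \<Longrightarrow> d v \<le> Suc (d u)"
      and parent: "\<And>v. 0 < d v \<Longrightarrow> \<exists>u. (u, v) \<in> F \<and> Suc (d u) = d v"
    by (rule distance_layers[OF \<open>sym F\<close>]) (rule that)
  \<comment> \<open>The root is fixed along with the distance, because the vertices above a layer
    are connected only within one component.\<close>
  define L where "L \<rho> n = {x \<in> W. r x = \<rho> \<and> d x = n}" for \<rho> n
  have "\<exists>c. c \<in> L \<rho> n \<rightarrow> {..<2 ^ k :: nat} \<and>
      (\<forall>u\<in>L \<rho> n. \<forall>v\<in>L \<rho> n. (u, v) \<in> E \<longrightarrow> c u \<noteq> c v)" for \<rho> n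
  proof (cases n)
    case 0
    \<comment> \<open>Nothing lies above layer 0, but it has at most one vertex and needs no
      induction hypothesis.\<close>
    have "u = v" if "u \<in> L \<rho> n" "v \<in> L \<rho> n" for u v
      using that d0[of u] d0[of v] 0 by (simp add: L_def)
    then have "\<forall>u\<in>L \<rho> n. \<forall>v\<in>L \<rho> n. (u, v) \<notin> E"
      using \<open>irrefl E\<close> by (metis irrefl_def)
    then show ?thesis by (intro exI[of _ "\<lambda>_. 0"]) auto
  next
    case n: (Suc m)
    define T where "T = {x \<in> W. r x = \<rho> \<and> d x < n}"
    \<comment> \<open>Following parents lowers the distance, so the walk to the root never leaves
      \<open>T\<close>.\<close>
    have to_root: "(x, \<rho>) \<in> rtrancl_on T E" if "x \<in> T" for x
      using that
    proof (induction "d x" arbitrary: x)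
      case 0
      then have "x = \<rho>" using d0[of x] by (simp add: T_def)
      then show ?case using 0 by simp
    next
      case (Suc i)
      then obtain u where u: "(u, x) \<in> F" "Suc (d u) = d x"
        using parent[of x] by auto
      then have "(x, u) \<in> E" "u \<in> T"
        using Suc.prems r_edge[OF u(1)] F_sym[OF u(1)] by (auto simp: F_def T_def)
      then show ?case
        using Suc u by (intro converse_rtrancl_on_into_rtrancl_on[of x u]) auto
    qed
    have conn: "(x, y) \<in> rtrancl_on T E" if "x \<in> T" "y \<in> T" for x y
      using to_root that rtrancl_on_sym[OF \<open>sym E\<close>, of T]
      by (meson rtrancl_on_trans symD)
    have dom: "\<exists>u\<in>T. (v, u) \<in> E" if v: "v \<in> L \<rho> n" for v
    proof -
      obtain u where u: "(u, v) \<in> F" "Suc (d u) = d v"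
        using parent[of v] v n by (auto simp: L_def)
      then show ?thesis
        using v r_edge[OF u(1)] F_sym[OF u(1)]
        by (intro bexI[of _ u]) (auto simp: F_def T_def L_def)
    qed
    have "\<not> dominating_sets E (L \<rho> n) (k + 2) S" for S
    proof
      assume S: "dominating_sets E (L \<rho> n) (k + 2) S"
      then have "S 1 \<noteq> {} \<and> S 1 \<subseteq> L \<rho> n"
        by (auto simp: dominating_sets_def)
      \<comment> \<open>As \<open>\<rho>\<close> is arbitrary and need not be a root,
        \<open>T\<close> could be empty; a vertex of \<open>S 1\<close> has a neighbour in
        \<open>T\<close>, which rules this out.\<close>
      then obtain v where "v \<in> L \<rho> n" by blast
      with dom have "T \<noteq> {}" by blast
      with dominating_sets_extend[OF S _ _ _ _ conn dom, of W] Suc.prems show False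
        by (auto simp: L_def T_def)
    qed
    then show ?thesis by (intro Suc.IH) blast
  qed
  then obtain c where
    c_range: "\<And>\<rho> n. c \<rho> n \<in> L \<rho> n \<rightarrow> {..<2 ^ k :: nat}" and
    c_proper: "\<And>\<rho> n u v. u \<in> L \<rho> n \<Longrightarrow> v \<in> L \<rho> n \<Longrightarrow> (u, v) \<in> E \<Longrightarrow> c \<rho> n u \<noteq> c \<rho> n v"
    by metis
  \<comment> \<open>Odd layers use the second palette, shifted by \<open>2 ^ k\<close>. All
    components share both palettes, since no edge joins two of them.\<close>
  define C where "C x = c (r x) (d x) x + (if even (d x) then 0 else 2 ^ k)" for x
  have c_less: "c (r x) (d x) x < 2 ^ k" if "x \<in> W" for x
    using c_range[of "r x" "d x"] that by (auto simp: L_def)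
  have "C u \<noteq> C v" if uv: "u \<in> W" "v \<in> W" "(u, v) \<in> E" for u v
  proof (cases "d u = d v")
    case True
    have "r u = r v" using uv r_edge by (auto simp: F_def)
    then show ?thesis
      using True uv c_proper[of u "r u" "d u" v] by (auto simp: C_def L_def)
  next
    case False
    have "(u, v) \<in> F" "(v, u) \<in> F"
      using uv F_sym[of u v] by (auto simp: F_def)
    \<comment> \<open>An edge between different layers joins consecutive ones, whose palettes are
      disjoint.\<close>
    then have "d v = Suc (d u) \<or> d u = Suc (d v)"
      using d_edge[of u v] d_edge[of v u] False by linarith
    then have "even (d u) \<noteq> even (d v)" by auto
    then show ?thesis
      using c_less[OF uv(1)] c_less[OF uv(2)] by (auto simp: C_def)
  qed
  moreover have "C \<in> W \<rightarrow> {..<2 ^ Suc k}"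
    using c_less by (fastforce simp: C_def)
  ultimately show ?case by blast
qed

lemma (in graph) graph_induce_subgraph:
  assumes "S \<subseteq> verts G"
  shows "graph (G \<restriction> S)"
proof -
  interpret H: wf_digraph "G \<restriction> S" by (rule wellformed_induce_subgraph)
  show ?thesis
  proof unfold_locales
    show "finite (verts (G \<restriction> S))"
      using assms finite_verts by (auto intro: finite_subset)
    show "symmetric (G \<restriction> S)"
      using sym_arcs by (fastforce simp: symmetric_conv)
  qed (auto simp: no_loops no_multi_arcs)
qed

text \<open>A walk confined to \<open>S\<close> uses only arcs with both ends in \<open>S\<close>,
  and these survive in the induced subgraph.\<close>

lemma connected_induce_subgraph:
  assumes "S \<noteq> {}" and "\<And>x y. x \<in> S \<Longrightarrow> y \<in> S \<Longrightarrow> (x, y) \<in> rtrancl_on S (arcs_ends G)"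
  shows "connected (G \<restriction> S)"
proof -
  have "(x, y) \<in> rtrancl_on S ((arcs_ends (G \<restriction> S))\<^sup>s)" if "(x, y) \<in> rtrancl_on S (arcs_ends G)" for x y
    using that
  proof induction
    case (step y z)
    then have "(y, z) \<in> (arcs_ends (G \<restriction> S))\<^sup>s"
      by (auto simp: symcl_def arcs_ends_conv)
    with step show ?case by (intro converse_rtrancl_on_into_rtrancl_on[of y z])
  qed auto
  then show ?thesis
    using assms by (simp add: connected_conv)
qed

text \<open>Induced subgraphs keep both arcs of an edge, so they are graphs as the model requires.
  This direction suffices for transferring the absence of models to vertex sets.\<close>

lemma (in graph) dominating_K_model_if_dominating_sets:
  assumes "dominating_sets (arcs_ends G) (verts G) t S"
  shows "dominating_K_model G t (\<lambda>i. G \<restriction> S i)"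
  using assms unfolding dominating_sets_def dominating_K_model_def
  by (auto intro!: graph_induce_subgraph subgraph_induce_subgraphI connected_induce_subgraph)

theorem theorem21:
  fixes G :: "('a, 'b) pre_digraph" and t :: nat
  assumes "t \<ge> 2"
    and "graph G"
    and "\<not> (\<exists>T. dominating_K_model G t T)"
  shows "colourable (2 ^ (t - 2)) G"
proof -
  interpret graph G by fact
  have "sym (arcs_ends G)"
    using sym_arcs by (simp add: symmetric_def)
  moreover have "irrefl (arcs_ends G)"
    using no_loops by (fastforce simp: irrefl_def arcs_ends_conv)
  moreover have "\<nexists>S. dominating_sets (arcs_ends G) (verts G) (t - 2 + 2) S"
    using assms(1,3) dominating_K_model_if_dominating_sets by (metis le_add_diff_inverse2)
  ultimately obtain c where "c \<in> verts G \<rightarrow> {..<2 ^ (t - 2) :: nat}"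
    "\<forall>u\<in>verts G. \<forall>v\<in>verts G. (u, v) \<in> arcs_ends G \<longrightarrow> c u \<noteq> c v"
    using colouring_if_no_dominating_sets by blast
  then show ?thesis
    unfolding colourable_def by (meson adj_in_verts)
qed

end
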